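(* Let $G=(V,E)$ be a connected finite graph that is $\delta$-hyperbolic. Then every disk $D(v,r)$ of $G$ and every set $C_{\leq k}(G)$, $k\geq 0$ an integer, is $(2\delta-1)$-pseudoconvex when $\delta>0$, and is convex when $0\leq\delta\leq 1/2$. Furthermore, $diam(C_{\leq k}(G))\leq 2k+4\delta+1$ for every integer $k\geq 0$.
   Context: Graphs are connected, finite, unweighted, undirected; $d(u,v)$ is the shortest-path distance. $G$ is $\delta$-hyperbolic ($\delta\ge 0$) if for any four vertices $u,v,w,x$ the two larger of the three sums $d(u,v)+d(w,x)$, $d(u,w)+d(v,x)$, $d(u,x)+d(v,w)$ differ by at most $2\delta$. The eccentricity is $e(v)=\max_{u\in V}d(v,u)$, $rad(G)=\min_v e(v)$, $C_{\leq k}(G)=\{v\in V: e(v)\le rad(G)+k\}$. $D(v,r)=\{u: d(u,v)\le r\}$. $I(x,y)=\{z: d(x,z)+d(z,y)=d(x,y)\}$. A set $S\subseteq V$ is convex if $I(x,y)\subseteq S$ for all $x,y\in S$; it is $\beta$-pseudoconvex ($\beta\ge0$) if for all $x,y\in S$ every $z\in I(x,y)\setminus S$ satisfies $\min\{d(z,x),d(z,y)\}\le\beta$. For $S\subseteq V$, $diam(S)=\max_{x,y\in S}d_G(x,y)$. *)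

theory Defs
  imports "Graph_Theory.Graph_Theory"
begin

text \<open>
  Graphs are symmetric finite digraphs. The locale \<^locale>\<open>pseudo_graph\<close> admits loops and parallel
  edges, neither of which affects distances; simple graphs are the special case \<^locale>\<open>graph\<close>.
\<close>

text \<open>
  Unit arc costs make the cost of a walk its length. The infimum is an extended real, which is
  infinite exactly when there is no walk from \<open>u\<close> to \<open>v\<close>; in a connected graph it is always finite.
\<close>

definition gdist :: "('a, 'b) pre_digraph \<Rightarrow> 'a \<Rightarrow> 'a \<Rightarrow> real" where
  "gdist G u v = real_of_ereal (wf_digraph.\<mu> G (\<lambda>_. 1) u v)"

text \<open>
  Sorting is ascending, so positions \<open>1\<close> and \<open>2\<close> hold the two larger of the three sums.
\<close>

definition hyperbolic :: "('a, 'b) pre_digraph \<Rightarrow> real \<Rightarrow> bool" where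
  "hyperbolic G \<delta> \<longleftrightarrow> \<delta> \<ge> 0 \<and>
     (\<forall>u\<in>verts G. \<forall>v\<in>verts G. \<forall>w\<in>verts G. \<forall>x\<in>verts G.
        let s = sort [gdist G u v + gdist G w x,
                      gdist G u w + gdist G v x,
                      gdist G u x + gdist G v w]
        in s ! 2 - s ! 1 \<le> 2 * \<delta>)"

definition ecc :: "('a, 'b) pre_digraph \<Rightarrow> 'a \<Rightarrow> real" where
  "ecc G v = Max ((\<lambda>u. gdist G v u) ` verts G)"

definition radius :: "('a, 'b) pre_digraph \<Rightarrow> real" where
  "radius G = Min (ecc G ` verts G)"

definition center_le :: "('a, 'b) pre_digraph \<Rightarrow> nat \<Rightarrow> 'a set" where
  "center_le G k = {v \<in> verts G. ecc G v \<le> radius G + real k}"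

definition disk :: "('a, 'b) pre_digraph \<Rightarrow> 'a \<Rightarrow> real \<Rightarrow> 'a set" where
  "disk G v r = {u \<in> verts G. gdist G u v \<le> r}"

definition interval :: "('a, 'b) pre_digraph \<Rightarrow> 'a \<Rightarrow> 'a \<Rightarrow> 'a set" where
  "interval G x y = {z \<in> verts G. gdist G x z + gdist G z y = gdist G x y}"

definition geodesically_convex :: "('a, 'b) pre_digraph \<Rightarrow> 'a set \<Rightarrow> bool" where
  "geodesically_convex G S \<longleftrightarrow> S \<subseteq> verts G \<and> (\<forall>x\<in>S. \<forall>y\<in>S. interval G x y \<subseteq> S)"

text \<open>
  The parameter \<open>\<beta>\<close> is not required to be nonnegative, so that \<open>\<beta> = 2 * \<delta> - 1\<close> is meaningful for
  every \<open>\<delta> > 0\<close>. For \<open>\<beta> < 0\<close> the condition says that no vertex of an interval lies outside \<open>S\<close>,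
  i.e. that \<open>S\<close> is convex.
\<close>

definition pseudoconvex :: "('a, 'b) pre_digraph \<Rightarrow> real \<Rightarrow> 'a set \<Rightarrow> bool" where
  "pseudoconvex G \<beta> S \<longleftrightarrow> S \<subseteq> verts G \<and>
     (\<forall>x\<in>S. \<forall>y\<in>S. \<forall>z \<in> interval G x y - S. min (gdist G z x) (gdist G z y) \<le> \<beta>)"

definition set_diam :: "('a, 'b) pre_digraph \<Rightarrow> 'a set \<Rightarrow> real" where
  "set_diam G S = Max ((\<lambda>(x, y). gdist G x y) ` (S \<times> S))"

end

theory Submission
  imports Defs
begin

text \<open>
  Suppose \<open>z\<close> lies on a geodesic between \<open>x\<close> and \<open>y\<close>, and \<open>v\<close> is a vertex with
  \<open>d(x,v) \<le> r\<close> and \<open>d(y,v) \<le> r\<close>. Since \<open>d(x,y) = d(x,z) + d(z,y)\<close>, the four-point condition for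
  \<open>v, z, x, y\<close> reads \<open>d(z,v) + min (d(z,x)) (d(z,y)) \<le> r + 2\<delta>\<close>. If \<open>z\<close> is outside the disk
  \<open>D(v,r)\<close>, integrality lets one take \<open>d(z,v) \<ge> r + 1\<close>, which is pseudoconvexity of disks;
  the set \<open>C\<^bsub>\<le>k\<^esub>(G)\<close> is the intersection of all disks of radius \<open>rad(G) + k\<close>. If instead \<open>z\<close> is
  a middle vertex of the geodesic, \<open>v\<close> is a vertex furthest from \<open>z\<close> and \<open>r = rad(G) + k\<close>, then
  \<open>d(z,v) \<ge> rad(G)\<close> bounds \<open>\<lfloor>d(x,y)/2\<rfloor>\<close> by \<open>k + 2\<delta>\<close>.
\<close>

section \<open>Four-point inequality and intersections\<close>

lemma sort3_gap:
  fixes a b c :: real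
  assumes "sort [a, b, c] ! 2 - sort [a, b, c] ! 1 \<le> e" and "0 \<le> e"
  shows "a \<le> max b c + e"
  using assms by (auto simp: numeral_2_eq_2 split: if_splits)

text \<open>If the left sum is a largest one, the right maximum is the middle sum and the sorted gap
  applies; otherwise the left sum is at most that maximum.\<close>

lemma hyperbolic_four_point:
  assumes "hyperbolic G \<delta>"
    and "u \<in> verts G" "v \<in> verts G" "w \<in> verts G" "x \<in> verts G"
  shows "gdist G u v + gdist G w x
    \<le> max (gdist G u w + gdist G v x) (gdist G u x + gdist G v w) + 2 * \<delta>"
  by (rule sort3_gap) (use assms in \<open>auto simp: hyperbolic_def Let_def\<close>)

text \<open>A point outside the intersection misses some \<open>S i\<close>, and that set contains
  both endpoints.\<close>

lemma pseudoconvex_INT: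
  assumes "I \<noteq> {}" and "\<And>i. i \<in> I \<Longrightarrow> pseudoconvex G \<beta> (S i)"
  shows "pseudoconvex G \<beta> (\<Inter>i\<in>I. S i)"
  unfolding pseudoconvex_def
proof (intro conjI ballI)
  show "(\<Inter>i\<in>I. S i) \<subseteq> verts G"
    using assms unfolding pseudoconvex_def by (meson INF_lower2 ex_in_conv)
  fix x y z
  assume x: "x \<in> (\<Inter>i\<in>I. S i)" and y: "y \<in> (\<Inter>i\<in>I. S i)"
    and z: "z \<in> interval G x y - (\<Inter>i\<in>I. S i)"
  then obtain i where i: "i \<in> I" "z \<in> interval G x y - S i"
    by auto
  with x y have "x \<in> S i" "y \<in> S i"
    by auto
  with i show "min (gdist G z x) (gdist G z y) \<le> \<beta>"
    using assms(2)[OF i(1)] unfolding pseudoconvex_def by metis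
qed

text \<open>Each arc is traded for some opposite arc supplied by symmetry. This yields the symmetry
  of \<open>gdist\<close>.\<close>

lemma (in sym_digraph) awalk_reverse:
  assumes "awalk u p v"
  obtains q where "awalk v q u" "length q = length p"
proof -
  have "\<exists>q. awalk v q u \<and> length q = length p"
    using assms
  proof (induction p arbitrary: u)
    case Nil
    then show ?case
      by (auto simp: awalk_Nil_iff)
  next
    case (Cons e p)
    then have e: "e \<in> arcs G" "u = tail G e" and "awalk (head G e) p v"
      by (auto simp: awalk_Cons_iff)
    then obtain q where q: "awalk v q (head G e)" "length q = length p"
      using Cons.IH by blast
    obtain e' where e': "e' \<in> arcs G" "tail G e' = head G e" "head G e' = tail G e"
      using sym_arcs e by (auto simp: symmetric_conv)
    then have "awalk (head G e) [e'] u"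
      using arc_implies_awalk e by metis
    with q show ?case
      by (intro exI[of _ "q @ [e']"]) (simp add: awalk_appendI del: awalk_append_iff)
  qed
  then show thesis
    using that by blast
qed

section \<open>Graph distance as an integer-valued metric\<close>

locale connected_pseudo_graph = pseudo_graph G
  for G :: "('a, 'b) pre_digraph" +
  assumes connected: "Digraph_Component.connected G"
begin

lemma verts_nonempty: "verts G \<noteq> {}"
  using connected by (simp add: connected_def strongly_connected_def)

text \<open>Walk lengths are natural numbers, so the infimum in \<open>gdist\<close> is attained.
  The metric facts below reduce to walks through this.\<close>

lemma shortest_awalk:
  assumes "u \<in> verts G" "v \<in> verts G"
  obtains p where "awalk u p v" "gdist G u v = real (length p)"
    "\<And>q. awalk u q v \<Longrightarrow> length p \<le> length q"
proof -
  have "u \<rightarrow>\<^sup>*\<^bsub>G\<^esub> v"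
    using connected assms reachable_mk_symmetric_eq[OF sym_arcs]
    by (auto simp: connected_def strongly_connected_def)
  then have "\<exists>p. awalk u p v"
    by (simp add: reachable_awalk)
  then obtain p where p: "awalk u p v" "\<And>q. awalk u q v \<Longrightarrow> length p \<le> length q"
    using ex_has_least_nat[of "\<lambda>p. awalk u p v" _ length] by blast
  have cost: "awalk_cost (\<lambda>_. 1) q = real (length q)" for q
    by (induction q) auto
  have "\<mu> (\<lambda>_. 1) u v = ereal (real (length p))"
    unfolding \<mu>_def cost by (rule INF_eqI) (use p in auto)
  then show thesis
    using that p by (simp add: gdist_def)
qed

lemma gdist_le_length:
  assumes "awalk u p v"
  shows "gdist G u v \<le> real (length p)"
  using assms shortest_awalk[of u v] by (metis awalk_hd_in_verts awalk_last_in_verts of_nat_le_iff)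

lemma gdist_Nats:
  assumes "u \<in> verts G" "v \<in> verts G"
  shows "gdist G u v \<in> \<nat>"
  using assms by (metis shortest_awalk of_nat_in_Nats)

lemma gdist_nonneg:
  assumes "u \<in> verts G" "v \<in> verts G"
  shows "gdist G u v \<ge> 0"
  using gdist_Nats[OF assms] by (auto elim: Nats_cases)

lemma gdist_eq_0_imp_eq:
  assumes "u \<in> verts G" "v \<in> verts G" "gdist G u v = 0"
  shows "u = v"
  using assms by (metis shortest_awalk awalk_Nil_iff length_0_conv of_nat_eq_0_iff)

lemma gdist_commute:
  assumes "u \<in> verts G" "v \<in> verts G"
  shows "gdist G u v = gdist G v u"
proof -
  have "gdist G y x \<le> gdist G x y" if "x \<in> verts G" "y \<in> verts G" for x y
    using that by (metis shortest_awalk awalk_reverse gdist_le_length)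
  with assms show ?thesis
    by (simp add: antisym)
qed

lemma gdist_triangle:
  assumes "u \<in> verts G" "v \<in> verts G" "w \<in> verts G"
  shows "gdist G u w \<le> gdist G u v + gdist G v w"
proof -
  obtain p where p: "awalk u p v" "gdist G u v = real (length p)"
    using assms shortest_awalk by metis
  obtain q where q: "awalk v q w" "gdist G v w = real (length q)"
    using assms shortest_awalk by metis
  show ?thesis
    using gdist_le_length[OF awalk_appendI[OF p(1) q(1)]] p q by simp
qed

lemma geodesic_point:
  assumes "u \<in> verts G" "v \<in> verts G" "real n \<le> gdist G u v"
  obtains z where "z \<in> interval G u v" "gdist G u z = real n"
proof -
  obtain p where p: "awalk u p v" "gdist G u v = real (length p)"
    using assms shortest_awalk by metis
  let ?z = "awlast u (take n p)"
  have z: "awalk u (take n p) ?z" "awalk ?z (drop n p) v"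
    using p(1) awalk_append_iff[of u "take n p" "drop n p" v] by simp_all
  then have "gdist G u ?z \<le> real n" "gdist G ?z v \<le> real (length p) - real n"
    using gdist_le_length[OF z(1)] gdist_le_length[OF z(2)] p assms(3) by auto
  moreover have "?z \<in> verts G"
    using z by blast
  \<comment> \<open>The two upper bounds add up to d(u,v), so the triangle inequality turns both
    into equalities.\<close>
  ultimately show thesis
    using gdist_triangle[of u ?z v] p assms
    by (intro that[of ?z]) (auto simp: interval_def)
qed

section \<open>Eccentricity, radius and centers\<close>

lemma ecc_le_iff:
  "ecc G v \<le> r \<longleftrightarrow> (\<forall>u\<in>verts G. gdist G v u \<le> r)"
  using verts_nonempty by (simp add: ecc_def)

lemma ecc_attained:
  obtains u where "u \<in> verts G" "ecc G v = gdist G v u"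
proof -
  have "ecc G v \<in> (\<lambda>u. gdist G v u) ` verts G"
    unfolding ecc_def using verts_nonempty by (intro Max_in) auto
  then show thesis
    using that by blast
qed

lemma radius_le_ecc:
  assumes "v \<in> verts G"
  shows "radius G \<le> ecc G v"
  using assms by (simp add: radius_def)

lemma center_le_eq_INT_disk:
  "center_le G k = (\<Inter>v\<in>verts G. disk G v (radius G + real k))"
  using verts_nonempty by (auto simp: center_le_def disk_def ecc_le_iff)

lemma center_le_nonempty: "center_le G k \<noteq> {}"
proof -
  have "radius G \<in> ecc G ` verts G"
    unfolding radius_def using verts_nonempty by (intro Min_in) auto
  then show ?thesis
    by (auto simp: center_le_def)
qed

section \<open>Pseudoconvexity and the diameter bound\<close>

lemma interval_four_point:
  assumes "hyperbolic G \<delta>" and "v \<in> verts G" "x \<in> verts G" "y \<in> verts G"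
    and "z \<in> interval G x y" and "gdist G x v \<le> r" "gdist G y v \<le> r"
  shows "gdist G z v + min (gdist G z x) (gdist G z y) \<le> r + 2 * \<delta>"
proof -
  have z: "z \<in> verts G" "gdist G x z + gdist G z y = gdist G x y"
    using assms by (auto simp: interval_def)
  \<comment> \<open>Subtract d(x,y) = d(z,x) + d(z,y) on both sides: the sum of two numbers minus
    their maximum is their minimum.\<close>
  show ?thesis
    using hyperbolic_four_point[OF assms(1) z(1) assms(2-4)] z assms
      gdist_commute[of x z] gdist_commute[of v y] gdist_commute[of v x]
    by (auto simp: min_def max_def split: if_splits)
qed

lemma pseudoconvex_disk:
  assumes "hyperbolic G \<delta>" and "v \<in> verts G"
  shows "pseudoconvex G (2 * \<delta> - 1) (disk G v r)"
  unfolding pseudoconvex_def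
proof (intro conjI ballI)
  show "disk G v r \<subseteq> verts G"
    by (auto simp: disk_def)
  fix x y z
  assume x: "x \<in> disk G v r" and y: "y \<in> disk G v r" and z: "z \<in> interval G x y - disk G v r"
  have V: "x \<in> verts G" "y \<in> verts G" "z \<in> verts G"
    using x y z by (auto simp: disk_def interval_def)
  obtain l m n where "gdist G x v = real l" "gdist G y v = real m" "gdist G z v = real n"
    using V assms gdist_Nats by (metis Nats_cases)
  moreover from this have "l < n" "m < n"
    using x y z V by (auto simp: disk_def)
  \<comment> \<open>The real \<open>r\<close> is replaced by the radius d(z,v) - 1, so that d(z,v)
    cancels in \<open>interval_four_point\<close>.\<close>
  ultimately have "gdist G x v \<le> gdist G z v - 1" "gdist G y v \<le> gdist G z v - 1"
    by auto
  then show "min (gdist G z x) (gdist G z y) \<le> 2 * \<delta> - 1"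
    using interval_four_point[OF assms V(1,2), of z "gdist G z v - 1"] z by auto
qed

lemma pseudoconvex_center_le:
  assumes "hyperbolic G \<delta>"
  shows "pseudoconvex G (2 * \<delta> - 1) (center_le G k)"
  unfolding center_le_eq_INT_disk
  using assms verts_nonempty by (intro pseudoconvex_INT pseudoconvex_disk)

text \<open>A point of the interval outside \<open>S\<close> would be at distance 0 from an
  endpoint, hence equal to a point of \<open>S\<close>.\<close>

lemma pseudoconvex_nonpos_imp_geodesically_convex:
  assumes "pseudoconvex G \<beta> S" and "\<beta> \<le> 0"
  shows "geodesically_convex G S"
  unfolding geodesically_convex_def
proof (intro conjI ballI subsetI)
  show S: "x \<in> verts G" if "x \<in> S" for x
    using that assms by (auto simp: pseudoconvex_def)
  fix x y z
  assume xy: "x \<in> S" "y \<in> S" and z: "z \<in> interval G x y"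
  show "z \<in> S"
  proof (rule ccontr)
    assume "z \<notin> S"
    then have "min (gdist G z x) (gdist G z y) \<le> 0"
      using assms xy z by (force simp: pseudoconvex_def)
    moreover have V: "z \<in> verts G" "x \<in> verts G" "y \<in> verts G"
      using S xy z by (auto simp: interval_def)
    then have "gdist G z x \<ge> 0" "gdist G z y \<ge> 0"
      using gdist_nonneg by auto
    ultimately have "gdist G z x = 0 \<or> gdist G z y = 0"
      by linarith
    then show False
      using gdist_eq_0_imp_eq V xy \<open>z \<notin> S\<close> by metis
  qed
qed

lemma gdist_center_le:
  assumes "hyperbolic G \<delta>" and x: "x \<in> center_le G k" and y: "y \<in> center_le G k"
  shows "gdist G x y \<le> 2 * real k + 4 * \<delta> + 1"
proof -
  have V: "x \<in> verts G" "y \<in> verts G"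
    using x y by (auto simp: center_le_def)
  obtain n where n: "gdist G x y = real n"
    using V gdist_Nats by (metis Nats_cases)
  \<comment> \<open>Rounding down puts the shorter half on the side of \<open>x\<close>, so both
    distances from \<open>z\<close> are at least \<open>n div 2\<close>.\<close>
  obtain z where z: "z \<in> interval G x y" "gdist G x z = real (n div 2)"
    using geodesic_point[OF V, of "n div 2"] n by auto
  then have zV: "z \<in> verts G" and "gdist G z y = real n - real (n div 2)"
    using n by (auto simp: interval_def)
  then have mid: "real (n div 2) \<le> min (gdist G z x) (gdist G z y)"
    using z gdist_commute[of x z] V by auto
  obtain v where v: "v \<in> verts G" "ecc G z = gdist G z v"
    by (rule ecc_attained)
  have "gdist G x v \<le> radius G + real k" "gdist G y v \<le> radius G + real k"
    using x y v by (auto simp: center_le_def ecc_le_iff)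
  then have "gdist G z v + min (gdist G z x) (gdist G z y) \<le> radius G + real k + 2 * \<delta>"
    using interval_four_point[OF assms(1) v(1) V z(1)] by blast
  \<comment> \<open>Here d(z,v) is the eccentricity of \<open>z\<close>, at least the radius, so the
    radius cancels.\<close>
  then have "real (n div 2) \<le> real k + 2 * \<delta>"
    using mid radius_le_ecc[OF zV] v by linarith
  \<comment> \<open>An odd distance accounts for the summand 1 of the bound.\<close>
  moreover have "real n \<le> 2 * real (n div 2) + 1"
    by linarith
  ultimately show ?thesis
    using n by linarith
qed

lemma set_diam_center_le:
  assumes "hyperbolic G \<delta>"
  shows "set_diam G (center_le G k) \<le> 2 * real k + 4 * \<delta> + 1"
proof -
  have "finite (center_le G k)"
    by (rule finite_subset[of _ "verts G"]) (auto simp: center_le_def)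
  then show ?thesis
    unfolding set_diam_def using center_le_nonempty gdist_center_le[OF assms]
    by (subst Max_le_iff) auto
qed

end

theorem theorem13:
  fixes G :: "('a, 'b) pre_digraph" and \<delta> :: real
  assumes "pseudo_graph G" and "Digraph_Component.connected G" and "hyperbolic G \<delta>"
  shows "(\<delta> > 0 \<longrightarrow>
            (\<forall>v\<in>verts G. \<forall>r. pseudoconvex G (2 * \<delta> - 1) (disk G v r)) \<and>
            (\<forall>k. pseudoconvex G (2 * \<delta> - 1) (center_le G k))) \<and>
         (0 \<le> \<delta> \<and> \<delta> \<le> 1 / 2 \<longrightarrow>
            (\<forall>v\<in>verts G. \<forall>r. geodesically_convex G (disk G v r)) \<and>
            (\<forall>k. geodesically_convex G (center_le G k))) \<and>
         (\<forall>k. set_diam G (center_le G k) \<le> 2 * real k + 4 * \<delta> + 1)"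
proof -
  interpret connected_pseudo_graph G
    using assms by (simp add: connected_pseudo_graph_def connected_pseudo_graph_axioms_def)
  have convex: "geodesically_convex G S"
    if "pseudoconvex G (2 * \<delta> - 1) S" "\<delta> \<le> 1 / 2" for S
    using that by (auto intro: pseudoconvex_nonpos_imp_geodesically_convex)
  show ?thesis
    using pseudoconvex_disk pseudoconvex_center_le set_diam_center_le convex assms(3) by auto
qed

end
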